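(* Let $S$ and $T$ be numerical semigroups. If the posets $(\mathfrak{I}_0(S),\subseteq)$ and $(\mathfrak{I}_0(T),\subseteq)$ are isomorphic, then $S=T$.
   Context: $\mathbb{N}$ denotes the set of non-negative integers. A numerical semigroup $S$ is a submonoid of $(\mathbb{N},+)$ such that $\mathbb{N}\setminus S$ is finite. The set of normalized ideals of $S$ is $\mathfrak{I}_0(S)=\{I\subseteq\mathbb{N} : I+S\subseteq I,\ \min(I)=0\}$, where $A+B=\{a+b : a\in A, b\in B\}$; it is ordered by set inclusion. Two posets $(P,\le_P)$ and $(Q,\le_Q)$ are isomorphic if there is a bijection $f:P\to Q$ such that for all $a,b\in P$, $a\le_P b$ if and only if $f(a)\le_Q f(b)$. *)

theory Defs
  imports Main "HOL-Library.Set_Algebras"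
begin

definition numerical_semigroup :: "nat set \<Rightarrow> bool" where
  "numerical_semigroup S \<longleftrightarrow>
     0 \<in> S \<and> (\<forall>a\<in>S. \<forall>b\<in>S. a + b \<in> S) \<and> finite (UNIV - S)"

(* I + S is the sumset. Non-emptiness is explicit because the minimum of the empty set does not
   exist, whereas LEAST is a total operator. *)
definition normalized_ideals :: "nat set \<Rightarrow> nat set set" where
  "normalized_ideals S = {I. I + S \<subseteq> I \<and> I \<noteq> {} \<and> (LEAST x. x \<in> I) = 0}"

definition poset_isomorphic ::
  "'a set \<Rightarrow> ('a \<Rightarrow> 'a \<Rightarrow> bool) \<Rightarrow> 'b set \<Rightarrow> ('b \<Rightarrow> 'b \<Rightarrow> bool) \<Rightarrow> bool" where
  "poset_isomorphic P leP Q leQ \<longleftrightarrow>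
     (\<exists>f. bij_betw f P Q \<and> (\<forall>a\<in>P. \<forall>b\<in>P. leP a b \<longleftrightarrow> leQ (f a) (f b)))"

end

(* Sending a gap x to S \<union> (x + S) identifies the gaps of S with the join-irreducible normalized
   ideals, and S \<union> (x + S) \<subseteq> S \<union> (y + S) iff x - y \<in> S. Hence the number of join-irreducibles
   above S \<union> (x + S) is the number of elements of S up to x, so the order determines, for every k,
   how many gaps have exactly k elements of S below them. These numbers are the lengths of the
   successive runs of gaps, and they determine S. *)

theory Submission
  imports Defs
begin

(* In a finite distributive lattice the join-irreducible elements are those with a greatest element
   strictly below them; this form is visibly invariant under order isomorphisms. *)
definition join_irreducibles :: "'a set set \<Rightarrow> 'a set set" where
  "join_irreducibles P = {J \<in> P. \<exists>K\<in>P. K \<subset> J \<and> (\<forall>L\<in>P. L \<subset> J \<longrightarrow> L \<subseteq> K)}"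

lemma join_irreducibles_image:
  assumes "inj_on f P" and le: "\<And>A B. A \<in> P \<Longrightarrow> B \<in> P \<Longrightarrow> A \<subseteq> B \<longleftrightarrow> f A \<subseteq> f B"
  shows "join_irreducibles (f ` P) = f ` join_irreducibles P"
proof -
  have "A \<subset> B \<longleftrightarrow> f A \<subset> f B" if "A \<in> P" "B \<in> P" for A B
    using that le[of A B] inj_on_eq_iff[OF assms(1), of A B] by (auto simp: psubset_eq)
  then have "f J \<in> join_irreducibles (f ` P) \<longleftrightarrow> J \<in> join_irreducibles P" if "J \<in> P" for J
    using that by (simp add: join_irreducibles_def le[symmetric] cong: bex_cong ball_cong)
  moreover have "join_irreducibles (f ` P) \<subseteq> f ` P" "join_irreducibles P \<subseteq> P"
    by (auto simp: join_irreducibles_def)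
  ultimately show ?thesis by blast
qed

text \<open>Such an \<open>f\<close> maps the join-irreducibles above \<open>J\<close> bijectively
  onto those above \<open>f J\<close>, so these counts are order invariants.\<close>

lemma card_join_irreducibles_image:
  assumes "inj_on f P" and le: "\<And>A B. A \<in> P \<Longrightarrow> B \<in> P \<Longrightarrow> A \<subseteq> B \<longleftrightarrow> f A \<subseteq> f B"
  shows "card {J \<in> join_irreducibles (f ` P). card {J' \<in> join_irreducibles (f ` P). J \<subseteq> J'} = k} =
    card {J \<in> join_irreducibles P. card {J' \<in> join_irreducibles P. J \<subseteq> J'} = k}"
proof -
  let ?A = "join_irreducibles P"
  have sub: "?A \<subseteq> P"
    by (auto simp: join_irreducibles_def)
  have inj: "inj_on f X" if "X \<subseteq> ?A" for X
    using assms(1) that sub by (blast intro: inj_on_subset)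
  have above: "card {J' \<in> f ` ?A. f J \<subseteq> J'} = card {J' \<in> ?A. J \<subseteq> J'}" if "J \<in> ?A" for J
  proof -
    have "{J' \<in> f ` ?A. f J \<subseteq> J'} = f ` {J' \<in> ?A. J \<subseteq> J'}"
      using that sub le by blast
    then show ?thesis by (simp add: card_image inj)
  qed
  have "{J \<in> f ` ?A. card {J' \<in> f ` ?A. J \<subseteq> J'} = k} = f ` {J \<in> ?A. card {J' \<in> ?A. J \<subseteq> J'} = k}"
    using above by auto
  then show ?thesis
    by (simp add: join_irreducibles_image[OF assms] card_image inj)
qed

lemma mem_normalized_ideals_iff:
  "I \<in> normalized_ideals S \<longleftrightarrow> 0 \<in> I \<and> (\<forall>i\<in>I. \<forall>s\<in>S. i + s \<in> I)"
proof -
  have "I \<noteq> {} \<and> (LEAST x. x \<in> I) = 0 \<longleftrightarrow> 0 \<in> I"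
    by (metis LeastI Least_eq_0 empty_iff equals0I)
  moreover have "I + S \<subseteq> I \<longleftrightarrow> (\<forall>i\<in>I. \<forall>s\<in>S. i + s \<in> I)"
    by (auto simp: set_plus_def)
  ultimately show ?thesis
    by (auto simp: normalized_ideals_def)
qed

text \<open>For a numerical semigroup \<open>S\<close> this is the least normalized ideal containing
  \<open>x\<close>; it equals \<open>S\<close> exactly when \<open>x \<in> S\<close>.\<close>

definition gap_ideal :: "nat set \<Rightarrow> nat \<Rightarrow> nat set" where
  "gap_ideal S x = S \<union> (+) x ` S"

context
  fixes S :: "nat set"
  assumes S: "numerical_semigroup S"
begin

lemma zero_mem: "0 \<in> S" and add_mem: "a \<in> S \<Longrightarrow> b \<in> S \<Longrightarrow> a + b \<in> S"
  using S by (auto simp: numerical_semigroup_def)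

lemma gap_ideal_mem: "gap_ideal S x \<in> normalized_ideals S"
  by (auto simp: mem_normalized_ideals_iff gap_ideal_def zero_mem add_mem add.assoc)

lemma self_mem_gap_ideal: "x \<in> gap_ideal S x"
  using zero_mem by (force simp: gap_ideal_def)

text \<open>A normalized ideal contains \<open>0\<close>, hence all of \<open>S\<close>, and
  together with \<open>x\<close> it contains the translate of \<open>S\<close> by
  \<open>x\<close>.\<close>

lemma gap_ideal_subset_iff:
  assumes "I \<in> normalized_ideals S"
  shows "gap_ideal S x \<subseteq> I \<longleftrightarrow> x \<in> I"
proof
  show "x \<in> I" if "gap_ideal S x \<subseteq> I"
    using that self_mem_gap_ideal by blast
  have "0 + s \<in> I" if "s \<in> S" for s
    using assms that unfolding mem_normalized_ideals_iff by blast
  then show "gap_ideal S x \<subseteq> I" if "x \<in> I"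
    using assms that by (auto simp: mem_normalized_ideals_iff gap_ideal_def)
qed

text \<open>Gaps avoid \<open>S\<close>, so two gaps with the same ideal lie in each other's
  translate of \<open>S\<close>, and each is at most the other.\<close>

lemma inj_on_gap_ideal: "inj_on (gap_ideal S) (- S)"
proof
  fix x y assume "x \<in> - S" "y \<in> - S" "gap_ideal S x = gap_ideal S y"
  then have "x \<in> (+) y ` S" "y \<in> (+) x ` S"
    using self_mem_gap_ideal[of x] self_mem_gap_ideal[of y] by (auto simp: gap_ideal_def)
  then show "x = y" by auto
qed

lemma join_irreducibles_normalized_ideals:
  "join_irreducibles (normalized_ideals S) = gap_ideal S ` (- S)"
proof (intro set_eqI iffI)
  fix J assume "J \<in> join_irreducibles (normalized_ideals S)"
  then obtain K where J: "J \<in> normalized_ideals S" and K: "K \<in> normalized_ideals S" "K \<subset> J"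
    and max: "\<And>L. L \<in> normalized_ideals S \<Longrightarrow> L \<subset> J \<Longrightarrow> L \<subseteq> K"
    by (auto simp: join_irreducibles_def)
  then obtain x where x: "x \<in> J" "x \<notin> K" by blast
  \<comment> \<open>The ideal generated by \<open>x\<close> lies in \<open>J\<close>; were it
    proper, maximality of \<open>K\<close> would give \<open>x \<in> K\<close>.\<close>
  have "gap_ideal S x = J"
    using max[OF gap_ideal_mem] gap_ideal_subset_iff[OF J] gap_ideal_subset_iff[OF K(1)] x
    by blast
  \<comment> \<open>\<open>gap_ideal S 0\<close> is \<open>S\<close>, so \<open>0 \<in> K\<close>
    yields \<open>S \<subseteq> K\<close>.\<close>
  moreover have "x \<notin> S"
    using gap_ideal_subset_iff[OF K(1), of 0] K(1) x
    by (auto simp: mem_normalized_ideals_iff gap_ideal_def)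
  ultimately show "J \<in> gap_ideal S ` (- S)" by blast
next
  fix J assume "J \<in> gap_ideal S ` (- S)"
  then obtain x where x: "x \<notin> S" and J: "J = gap_ideal S x" by blast
  \<comment> \<open>Dropping the generator leaves the greatest normalized ideal strictly below
    \<open>J\<close>, since one that contains \<open>x\<close> contains all of
    \<open>J\<close>.\<close>
  have "J - {x} \<in> normalized_ideals S"
    unfolding mem_normalized_ideals_iff
  proof (intro conjI ballI)
    show "0 \<in> J - {x}"
      using x zero_mem by (cases "x = 0") (auto simp: J gap_ideal_def)
    fix i s assume i: "i \<in> J - {x}" and s: "s \<in> S"
    have "i + s \<in> J"
      using gap_ideal_mem i s by (auto simp: J mem_normalized_ideals_iff)
    \<comment> \<open>If \<open>i \<in> S\<close>, equality would put \<open>x\<close> in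
      \<open>S\<close>; if \<open>i = x + t\<close>, it would force \<open>t = 0\<close> and hence
      \<open>i = x\<close>.\<close>
    moreover have "i + s \<noteq> x"
      using i s x add_mem by (auto simp: J gap_ideal_def)
    ultimately show "i + s \<in> J - {x}" by blast
  qed
  moreover have "J - {x} \<subset> J"
    using self_mem_gap_ideal J by blast
  moreover have "L \<subseteq> J - {x}" if "L \<in> normalized_ideals S" "L \<subset> J" for L
    using gap_ideal_subset_iff[OF that(1)] that(2) J by blast
  ultimately show "J \<in> join_irreducibles (normalized_ideals S)"
    using gap_ideal_mem J unfolding join_irreducibles_def by blast
qed

text \<open>The ideals counted come from the gaps \<open>y\<close> with
  \<open>x \<in> gap_ideal S y\<close>. Since \<open>x\<close> is a gap, these are the numbers
  \<open>x - s\<close> with \<open>s \<in> S\<close> and \<open>s \<le> x\<close>: if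
  \<open>x - s\<close> were in \<open>S\<close>, so would be \<open>x\<close>.\<close>

lemma card_join_irreducibles_above:
  assumes "x \<notin> S"
  shows "card {J \<in> join_irreducibles (normalized_ideals S). gap_ideal S x \<subseteq> J} = card (S \<inter> {..x})"
proof -
  have "{J \<in> join_irreducibles (normalized_ideals S). gap_ideal S x \<subseteq> J} =
      gap_ideal S ` {y \<in> - S. x \<in> gap_ideal S y}"
    unfolding join_irreducibles_normalized_ideals
    using gap_ideal_subset_iff[OF gap_ideal_mem] by blast
  also have "{y \<in> - S. x \<in> gap_ideal S y} = (\<lambda>s. x - s) ` (S \<inter> {..x})"
  proof (intro set_eqI iffI)
    fix y assume "y \<in> {y \<in> - S. x \<in> gap_ideal S y}"
    then show "y \<in> (\<lambda>s. x - s) ` (S \<inter> {..x})"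
      using assms by (force simp: gap_ideal_def)
  next
    fix y assume "y \<in> (\<lambda>s. x - s) ` (S \<inter> {..x})"
    then obtain s where s: "s \<in> S" "x = y + s" by force
    then show "y \<in> {y \<in> - S. x \<in> gap_ideal S y}"
      using assms add_mem by (auto simp: gap_ideal_def)
  qed
  finally have "{J \<in> join_irreducibles (normalized_ideals S). gap_ideal S x \<subseteq> J} =
      gap_ideal S ` (\<lambda>s. x - s) ` (S \<inter> {..x})" .
  moreover have "inj_on (gap_ideal S) ((\<lambda>s. x - s) ` (S \<inter> {..x}))"
  proof (rule inj_on_subset[OF inj_on_gap_ideal], safe)
    fix s assume "s \<in> S" "s \<le> x" "x - s \<in> S"
    then show False using add_mem[of "x - s" s] assms by simp
  qed
  moreover have "inj_on (\<lambda>s. x - s) (S \<inter> {..x})"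
    by (auto simp: inj_on_def)
  ultimately show ?thesis by (simp add: card_image)
qed

text \<open>Trades a count of gaps for one that depends only on the inclusion order of
  \<open>normalized_ideals S\<close>.\<close>

lemma card_gaps_eq_card_join_irreducibles:
  "card {x \<in> - S. card (S \<inter> {..x}) = k} =
    card {J \<in> join_irreducibles (normalized_ideals S).
      card {J' \<in> join_irreducibles (normalized_ideals S). J \<subseteq> J'} = k}"
proof -
  have "{J \<in> join_irreducibles (normalized_ideals S).
      card {J' \<in> join_irreducibles (normalized_ideals S). J \<subseteq> J'} = k} =
    gap_ideal S ` {x \<in> - S. card (S \<inter> {..x}) = k}"
    using card_join_irreducibles_above join_irreducibles_normalized_ideals by auto
  moreover have "inj_on (gap_ideal S) {x \<in> - S. card (S \<inter> {..x}) = k}"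
    by (rule inj_on_subset[OF inj_on_gap_ideal]) auto
  ultimately show ?thesis by (simp add: card_image)
qed

end

text \<open>Every gap of \<open>A\<close> with count \<open>k\<close> lies below \<open>m\<close>,
  where both sets agree, so it is a gap of \<open>B\<close> with the same count; \<open>m\<close> is
  one more such gap of \<open>B\<close>.\<close>

lemma card_gaps_less:
  fixes A B :: "nat set"
  assumes fin: "finite (- B)" and below: "\<And>x. x < m \<Longrightarrow> x \<in> A \<longleftrightarrow> x \<in> B"
    and m: "m \<in> A" "m \<notin> B" and k: "k = card (B \<inter> {..m})"
  shows "card {x \<in> - A. card (A \<inter> {..x}) = k} < card {x \<in> - B. card (B \<inter> {..x}) = k}"
proof (rule psubset_card_mono)
  show "finite {x \<in> - B. card (B \<inter> {..x}) = k}"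
    by (rule finite_subset[OF _ fin]) auto
  \<comment> \<open>From \<open>m\<close> on, the count for \<open>A\<close> is at least
    \<open>k + 1\<close>: it includes the \<open>k\<close> elements of \<open>B\<close> below
    \<open>m\<close>, and \<open>m\<close> itself.\<close>
  have less: "x < m" if "card (A \<inter> {..x}) = k" for x
  proof (rule ccontr)
    assume "\<not> x < m"
    moreover have "y < m" if "y \<in> B" "y \<le> m" for y
      using that m(2) by (cases "y = m") auto
    ultimately have "insert m (B \<inter> {..m}) \<subseteq> A \<inter> {..x}"
      using below m(1) by auto
    then have "card (insert m (B \<inter> {..m})) \<le> card (A \<inter> {..x})"
      by (intro card_mono) auto
    then show False using that m(2) k by simp
  qed
  have Int_eq: "A \<inter> {..x} = B \<inter> {..x}" if "x < m" for x
    using below that by auto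
  have "{x \<in> - A. card (A \<inter> {..x}) = k} \<subseteq> {x \<in> - B. card (B \<inter> {..x}) = k}"
  proof
    fix x assume x: "x \<in> {x \<in> - A. card (A \<inter> {..x}) = k}"
    then have "x < m" by (simp add: less)
    then show "x \<in> {x \<in> - B. card (B \<inter> {..x}) = k}"
      using x below Int_eq by simp
  qed
  moreover have "m \<in> {x \<in> - B. card (B \<inter> {..x}) = k}" "m \<notin> {x \<in> - A. card (A \<inter> {..x}) = k}"
    using m by (simp_all add: k)
  ultimately show "{x \<in> - A. card (A \<inter> {..x}) = k} \<subset> {x \<in> - B. card (B \<inter> {..x}) = k}"
    by blast
qed

text \<open>At the least point of disagreement, the set missing it has strictly more gaps for a
  suitable \<open>k\<close>.\<close>

lemma eq_if_card_gaps_eq: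
  fixes A B :: "nat set"
  assumes "finite (- A)" "finite (- B)"
    and eq: "\<And>k. card {x \<in> - A. card (A \<inter> {..x}) = k} = card {x \<in> - B. card (B \<inter> {..x}) = k}"
  shows "A = B"
proof (rule ccontr)
  assume "A \<noteq> B"
  then have ex: "\<exists>m. m \<in> A \<longleftrightarrow> m \<notin> B" by blast
  define m where "m = (LEAST m. m \<in> A \<longleftrightarrow> m \<notin> B)"
  have m: "m \<in> A \<longleftrightarrow> m \<notin> B"
    unfolding m_def using ex by (rule LeastI_ex)
  have below: "x \<in> A \<longleftrightarrow> x \<in> B" if "x < m" for x
    using not_less_Least[OF that[unfolded m_def]] by blast
  show False
  proof (cases "m \<in> A")
    case True
    then have "m \<notin> B" using m by simp
    from card_gaps_less[OF assms(2) below True this refl] show False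
      unfolding eq by simp
  next
    case False
    then have "m \<in> B" using m by simp
    from card_gaps_less[OF assms(1) below[symmetric] this False refl] show False
      unfolding eq by simp
  qed
qed

theorem theorem12:
  fixes S T :: "nat set"
  assumes "numerical_semigroup S" and "numerical_semigroup T"
    and "poset_isomorphic (normalized_ideals S) (\<subseteq>) (normalized_ideals T) (\<subseteq>)"
  shows "S = T"
proof (rule eq_if_card_gaps_eq)
  show "finite (- S)" "finite (- T)"
    using assms(1,2) by (auto simp: numerical_semigroup_def Compl_eq_Diff_UNIV)
  obtain f where f: "bij_betw f (normalized_ideals S) (normalized_ideals T)"
    and le: "\<forall>A\<in>normalized_ideals S. \<forall>B\<in>normalized_ideals S. A \<subseteq> B \<longleftrightarrow> f A \<subseteq> f B"
    using assms(3) unfolding poset_isomorphic_def by (elim exE conjE)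
  \<comment> \<open>Rewriting \<open>normalized_ideals T\<close> as the image of
    \<open>normalized_ideals S\<close> under \<open>f\<close> reduces this to the invariance of the
    counts.\<close>
  show "card {x \<in> - S. card (S \<inter> {..x}) = k} = card {x \<in> - T. card (T \<inter> {..x}) = k}" for k
    unfolding card_gaps_eq_card_join_irreducibles[OF assms(1)]
      card_gaps_eq_card_join_irreducibles[OF assms(2)] bij_betw_imp_surj_on[OF f, symmetric]
    by (rule card_join_irreducibles_image[OF bij_betw_imp_inj_on[OF f] le[rule_format], symmetric])
qed

end
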